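(* Let $K$ be a sufficiently large constant and define $\Pi_{\mathsf{Yes}}=\{\mathcal{D}\text{ over }[N]: |\mathrm{supp}(\mathcal{D})|=N^{2/3}/K,\ \mathcal{D}\text{ flat}\}$ and $\Pi_{\mathsf{No}}=\{\mathcal{D}\text{ over }[N]: |\mathrm{supp}(\mathcal{D})|=N^{2/3},\ \mathcal{D}\text{ flat}\}$. Every $\mathsf{BPP}$ tester using a $\texttt{PCond}$ oracle for the promise problem $(\Pi_{\mathsf{Yes}},\Pi_{\mathsf{No}})$ with failure probability $0.01$ must make $\Omega(N^{1/3})$ queries.
   Context: A distribution is flat if it is uniform over its support. A $\texttt{PCond}$ oracle for $\mathcal{D}$ accepts a set $S\subseteq[N]$ with $|S|=2$ or $S=[N]$ and returns $x\in S$ with probability $\mathcal{D}[x]/\mathcal{D}(S)$ (or $\mathsf{FAIL}$/$\bot$ if $\mathcal{D}(S)=0$); queries with $S=[N]$ are ordinary samples, and all oracle calls count as queries. A $\mathsf{BPP}$ tester for the promise problem with failure probability $\beta$ is a randomized algorithm that outputs $\mathsf{Yes}$ with probability at least $1-\beta$ for every $\mathcal{D}\in\Pi_{\mathsf{Yes}}$ and outputs $\mathsf{No}$ with probability at least $1-\beta$ for every $\mathcal{D}\in\Pi_{\mathsf{No}}$. *)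

theory Defs
  imports "HOL-Probability.Probability"
begin

datatype verdict = Yes | No

text \<open>
  Randomized adaptive oracle algorithms, as decision trees with oracle queries of type
  \<open>'q\<close> answered by elements of \<open>'r\<close>.  \<open>Random p\<close> draws the
  rest of the computation from \<open>p\<close>, at no query cost.  The generated set function
  \<open>queries\<close> collects all queries at all nodes of the tree.
\<close>

datatype (queries: 'q, dead 'r) algorithm =
    Output verdict
  | Random "('q, 'r) algorithm pmf"
  | Query 'q "'r \<Rightarrow> ('q, 'r) algorithm"

text \<open>
  The joint distribution of the verdict and the number of oracle calls made, each call
  being answered with fresh randomness.
\<close>

primrec run :: "('q \<Rightarrow> 'r pmf) \<Rightarrow> ('q, 'r) algorithm \<Rightarrow> (verdict \<times> nat) pmf" where
  "run orc (Output v) = return_pmf (v, 0)"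
| "run orc (Random p) = join_pmf (map_pmf (run orc) p)"
| "run orc (Query s k) =
     bind_pmf (orc s) (\<lambda>r. map_pmf (\<lambda>(v, n). (v, Suc n)) (run orc (k r)))"

definition distributions_over :: "nat \<Rightarrow> nat pmf set" where
  "distributions_over N = {D. set_pmf D \<subseteq> {1..N}}"

definition flat :: "'a pmf \<Rightarrow> bool" where
  "flat D \<longleftrightarrow> finite (set_pmf D) \<and> D = pmf_of_set (set_pmf D)"

definition pcond_queries :: "nat \<Rightarrow> nat set set" where
  "pcond_queries N = {S. S \<subseteq> {1..N} \<and> (card S = 2 \<or> S = {1..N})}"

text \<open>The answer \<open>None\<close> stands for \<open>FAIL\<close>.\<close>

definition pcond :: "nat pmf \<Rightarrow> nat set \<Rightarrow> nat option pmf" where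
  "pcond D S =
     (if measure_pmf.prob D S = 0 then return_pmf None else map_pmf Some (cond_pmf D S))"

definition bpp_tester ::
    "nat \<Rightarrow> nat pmf set \<Rightarrow> nat pmf set \<Rightarrow> real \<Rightarrow> (nat set, nat option) algorithm \<Rightarrow> bool" where
  "bpp_tester N PY PN \<beta> A \<longleftrightarrow>
     queries A \<subseteq> pcond_queries N \<and>
     (\<forall>D\<in>PY. measure_pmf.prob (run (pcond D) A) {(v, n). v = Yes} \<ge> 1 - \<beta>) \<and>
     (\<forall>D\<in>PN. measure_pmf.prob (run (pcond D) A) {(v, n). v = No} \<ge> 1 - \<beta>)"

text \<open>
  The query bound is worst case over the internal randomness and the oracle answers, and is
  only required on inputs satisfying the promise; a lower bound on such \<open>q\<close> is
  therefore also one on the worst case over all distributions.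
\<close>

definition makes_at_most :: "nat \<Rightarrow> nat pmf set \<Rightarrow> (nat set, nat option) algorithm \<Rightarrow> bool" where
  "makes_at_most q P A \<longleftrightarrow> (\<forall>D\<in>P. \<forall>(v, n)\<in>set_pmf (run (pcond D) A). n \<le> q)"

text \<open>
  Support sizes are rounded down, so that both sides of the promise are nonempty for all
  large \<open>N\<close> (otherwise constant testers would need no queries).  When the sizes are
  integers, the rounding has no effect.
\<close>

definition Pi_Yes :: "real \<Rightarrow> nat \<Rightarrow> nat pmf set" where
  "Pi_Yes K N =
     {D \<in> distributions_over N. card (set_pmf D) = nat \<lfloor>real N powr (2/3) / K\<rfloor> \<and> flat D}"

definition Pi_No :: "nat \<Rightarrow> nat pmf set" where
  "Pi_No N =
     {D \<in> distributions_over N. card (set_pmf D) = nat \<lfloor>real N powr (2/3)\<rfloor> \<and> flat D}"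

end

theory Submission
  imports Defs "HOL-Real_Asymp.Real_Asymp"
begin

text \<open>
  Let the support be a uniformly random set of size \<open>s\<close>, where \<open>s\<close> is of order
  \<open>N powr (2/3)\<close>. With \<open>q\<close> queries, \<open>q\<close> of order \<open>N powr (1/3)\<close>, the samples are pairwise
  distinct except with probability about \<open>q\<^sup>2 / s\<close>, and no point of a pair query lies in the support
  without having been sampled before, except with probability about \<open>2 q s / N\<close>. Outside these
  events the answers follow an ideal process that does not depend on \<open>s\<close>. Hence for both support
  sizes each verdict has at least \<open>1 - q \<delta>\<close> times its ideal probability, with
  \<open>\<delta> = 4 / N powr (1/3)\<close>. The two wrong verdicts then have probabilities summing to at
  least \<open>1 - q \<delta> \<ge> 1/2\<close>, whereas a tester only allows \<open>1/50\<close>.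
\<close>

section \<open>Consistent supports and the ideal process\<close>

text \<open>A uniformly random support of size \<open>s\<close>, conditioned on containing
  \<open>X\<close> and avoiding \<open>Y\<close>, is uniform on this family. Cardinalities and sums
  over it therefore stand in for conditional probabilities.\<close>

definition supports :: "nat \<Rightarrow> nat \<Rightarrow> nat set \<Rightarrow> nat set \<Rightarrow> nat set set" where
  "supports N s X Y = {S. X \<subseteq> S \<and> S \<subseteq> {1..N} - Y \<and> card S = s}"

text \<open>
  \<open>X\<close> is the set of points sampled so far, and \<open>Y\<close> the set of points known to lie outside the
  support. Samples are always new; an unsampled point of a pair query is always outside the support.
\<close>

primrec ideal :: "nat \<Rightarrow> (nat set, nat option) algorithm \<Rightarrow> nat set \<Rightarrow> nat set \<Rightarrow> verdict pmf" where
  "ideal N (Output v) X Y = return_pmf v"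
| "ideal N (Random p) X Y = bind_pmf (map_pmf (ideal N) p) (\<lambda>f. f X Y)"
| "ideal N (Query T k) X Y =
     (if card T = 2
      then bind_pmf (if T \<inter> X = {} then return_pmf None else map_pmf Some (pmf_of_set (T \<inter> X)))
             (\<lambda>r. ideal N (k r) X (Y \<union> (T - X)))
      else bind_pmf (map_pmf Some (pmf_of_set ({1..N} - X - Y)))
             (\<lambda>r. ideal N (k r) (insert (the r) X) Y))"

section \<open>Counting consistent supports\<close>

lemma finite_supports [simp]: "finite (supports N s X Y)"
  by (rule finite_subset[of _ "Pow {1..N}"]) (auto simp: supports_def)

text \<open>Removing \<open>X\<close> matches these supports with the subsets of size
  \<open>s - card X\<close> of the undecided points \<open>{1..N} - X - Y\<close>.\<close>

lemma card_supports:
  assumes "X \<subseteq> {1..N}" "Y \<subseteq> {1..N}" "X \<inter> Y = {}" "card X \<le> s"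
  shows "card (supports N s X Y) = (N - card X - card Y) choose (s - card X)"
proof -
  have fX: "finite X" and fY: "finite Y"
    using assms finite_subset by blast+
  have "bij_betw (\<lambda>B. B \<union> X) {B. B \<subseteq> {1..N} - X - Y \<and> card B = s - card X} (supports N s X Y)"
  proof (rule bij_betwI[where g = "\<lambda>S. S - X"])
    show "(\<lambda>B. B \<union> X) \<in> {B. B \<subseteq> {1..N} - X - Y \<and> card B = s - card X} \<rightarrow> supports N s X Y"
    proof
      fix B assume B: "B \<in> {B. B \<subseteq> {1..N} - X - Y \<and> card B = s - card X}"
      then have "finite B" using finite_subset[of B "{1..N}"] by auto
      then have "card (B \<union> X) = card B + card X"
        using B fX by (intro card_Un_disjoint) auto
      then show "B \<union> X \<in> supports N s X Y"
        using B assms by (auto simp: supports_def)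
    qed
    show "(\<lambda>S. S - X) \<in> supports N s X Y \<rightarrow> {B. B \<subseteq> {1..N} - X - Y \<and> card B = s - card X}"
      using fX by (auto simp: supports_def card_Diff_subset)
  qed (auto simp: supports_def)
  then have "card (supports N s X Y) = card {B. B \<subseteq> {1..N} - X - Y \<and> card B = s - card X}"
    by (rule bij_betw_same_card[symmetric])
  also have "\<dots> = card ({1..N} - X - Y) choose (s - card X)"
    by (rule n_subsets) simp
  also have "card ({1..N} - X - Y) = N - card X - card Y"
  proof -
    have "Y \<subseteq> {1..N} - X" using assms by auto
    then show ?thesis using fX fY assms by (simp add: card_Diff_subset)
  qed
  finally show ?thesis .
qed

text \<open>This is the absorption identity for binomial coefficients. Read as a ratio, an undecided
  point lies in a random consistent support with probability
  \<open>(s - card X) / (N - card X - card Y)\<close>.\<close>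

lemma card_supports_insert:
  assumes "X \<subseteq> {1..N}" "Y \<subseteq> {1..N}" "X \<inter> Y = {}" "z \<in> {1..N} - X - Y" "card X \<le> s"
  shows "(N - card X - card Y) * card (supports N s (insert z X) Y)
       = (s - card X) * card (supports N s X Y)"
\<comment> \<open>If \<open>X\<close> already has size \<open>s\<close>, then
  \<open>card_supports\<close> does not apply to \<open>insert z X\<close>, because
  \<open>s - card (insert z X)\<close> would truncate. Both sides are 0 here.\<close>
proof (cases "card X = s")
  case True
  have "supports N s (insert z X) Y = {}"
  proof -
    have "card S \<noteq> s" if "insert z X \<subseteq> S" "S \<subseteq> {1..N}" for S
    proof -
      have "finite S" using that finite_subset by blast
      then have "card (insert z X) \<le> card S" using that by (intro card_mono) auto
      moreover have "card (insert z X) = Suc (card X)"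
        using assms finite_subset[of X "{1..N}"] by simp
      ultimately show ?thesis using True by simp
    qed
    then show ?thesis by (auto simp: supports_def)
  qed
  with True show ?thesis by simp
next
  case False
  have fX: "finite X" and fY: "finite Y"
    using assms finite_subset by blast+
  have cz: "card (insert z X) = Suc (card X)" using assms fX by simp
  have "card (insert z (X \<union> Y)) \<le> card {1..N}"
    using assms by (intro card_mono) auto
  moreover have "card (insert z (X \<union> Y)) = Suc (card X + card Y)"
    using assms fX fY by (simp add: card_Un_disjoint)
  ultimately have "Suc (card X + card Y) \<le> N" by simp
  then obtain u where u: "N - card X - card Y = Suc u" "N - Suc (card X) - card Y = u"
    by (metis Suc_diff_Suc Suc_le_lessD diff_Suc_eq_diff_pred diff_commute diff_diff_left diff_Suc_1)
  obtain r where r: "s - card X = Suc r" "s - Suc (card X) = r"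
    using False assms(5) by (metis Suc_diff_Suc le_neq_implies_less)
  have "card (supports N s (insert z X) Y) = u choose r"
    using card_supports[of "insert z X" N Y s] assms cz u r False by simp
  moreover have "card (supports N s X Y) = Suc u choose Suc r"
    using card_supports[of X N Y s] assms u r by simp
  ultimately show ?thesis
    using u r Suc_times_binomial_eq[of u r] by simp
qed

lemma real_card_supports_insert:
  assumes "X \<subseteq> {1..N}" "Y \<subseteq> {1..N}" "X \<inter> Y = {}" "z \<in> {1..N} - X - Y" "card X \<le> s"
    and "card X + card Y \<le> N"
  shows "(real N - card X - card Y) * card (supports N s (insert z X) Y)
       = (real s - card X) * card (supports N s X Y)"
proof -
  have "real (N - card X - card Y) = real N - card X - card Y" "real (s - card X) = real s - card X"
    using assms by linarith+
  then show ?thesis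
    using arg_cong[OF card_supports_insert[OF assms(1-5)], of real] by simp
qed

text \<open>Union bound over the at most two points of \<open>Z\<close>: those in \<open>Y\<close>
  are excluded already, and each other one lies in at most a fraction \<open>\<delta> / 2\<close> of
  the supports. This is the cost of answering a pair query as if its unsampled points were outside
  the support.\<close>

lemma card_supports_exclude:
  assumes "X \<subseteq> {1..N}" "Y \<subseteq> {1..N}" "X \<inter> Y = {}" "card X \<le> s"
    and "Z \<subseteq> {1..N}" "Z \<inter> X = {}" "card Z \<le> 2"
    and "0 \<le> \<delta>" "2 * real s \<le> \<delta> * (real N - card X - card Y)" "card X + card Y < N"
  shows "(1 - \<delta>) * card (supports N s X Y) \<le> card (supports N s X (Y \<union> Z))"
proof -
  let ?C = "supports N s X Y"
  let ?u = "real N - card X - card Y"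
  have u: "?u > 0" using assms by linarith
  have fZ: "finite Z" using assms finite_subset by blast
  have bound: "card (supports N s (insert z X) Y) \<le> \<delta> / 2 * card ?C" if "z \<in> Z - Y" for z
  proof -
    have "?u * card (supports N s (insert z X) Y) = (real s - card X) * card ?C"
      by (rule real_card_supports_insert) (use assms that in auto)
    also have "\<dots> \<le> (\<delta> / 2 * ?u) * card ?C"
      using assms(9) by (intro mult_right_mono) (auto simp: algebra_simps)
    finally have "?u * card (supports N s (insert z X) Y) \<le> ?u * (\<delta> / 2 * card ?C)"
      by (simp add: algebra_simps)
    then show ?thesis using u by (simp only: mult_le_cancel_left_pos)
  qed
  have "?C \<subseteq> supports N s X (Y \<union> Z) \<union> (\<Union>z\<in>Z - Y. supports N s (insert z X) Y)"
    by (auto simp: supports_def)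
  then have "card ?C \<le> card (supports N s X (Y \<union> Z) \<union> (\<Union>z\<in>Z - Y. supports N s (insert z X) Y))"
    using fZ by (intro card_mono) auto
  also have "\<dots> \<le> card (supports N s X (Y \<union> Z)) + card (\<Union>z\<in>Z - Y. supports N s (insert z X) Y)"
    by (rule card_Un_le)
  also have "\<dots> \<le> card (supports N s X (Y \<union> Z)) + (\<Sum>z\<in>Z - Y. card (supports N s (insert z X) Y))"
    using fZ by (intro add_left_mono card_UN_le) auto
  finally have "real (card ?C) \<le>
      card (supports N s X (Y \<union> Z)) + (\<Sum>z\<in>Z - Y. real (card (supports N s (insert z X) Y)))"
    by (metis of_nat_add of_nat_le_iff of_nat_sum)
  also have "(\<Sum>z\<in>Z - Y. real (card (supports N s (insert z X) Y)))
      \<le> real (card (Z - Y)) * (\<delta> / 2 * card ?C)"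
    by (rule sum_bounded_above) (rule bound)
  also have "\<dots> \<le> 2 * (\<delta> / 2 * card ?C)"
  proof (rule mult_right_mono)
    have "card (Z - Y) \<le> card Z" using fZ by (intro card_mono) auto
    then show "real (card (Z - Y)) \<le> 2" using assms by linarith
  qed (use assms in auto)
  finally show ?thesis by (simp add: algebra_simps)
qed

section \<open>Oracle answers and mixtures\<close>

text \<open>Conditioning a uniform distribution leaves a uniform one, so the answer depends on
  \<open>S\<close> only through \<open>T \<inter> S\<close>.\<close>

lemma pcond_pmf_of_set:
  assumes "finite S" "S \<noteq> {}"
  shows "pcond (pmf_of_set S) T =
    (if T \<inter> S = {} then return_pmf None else map_pmf Some (pmf_of_set (T \<inter> S)))"
proof (cases "T \<inter> S = {}")
  case True
  then show ?thesis using assms by (simp add: pcond_def measure_pmf_of_set Int_commute)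
next
  case False
  have ne: "set_pmf (pmf_of_set S) \<inter> T \<noteq> {}" using False assms by auto
  have "cond_pmf (pmf_of_set S) T = pmf_of_set (T \<inter> S)"
    using False assms
    by (intro pmf_eqI) (auto simp: pmf_cond[OF ne] measure_pmf_of_set Int_commute indicator_def)
  then show ?thesis
    using False assms by (simp add: pcond_def measure_pmf_of_set Int_commute)
qed

lemma map_fst_run_Query:
  "map_pmf fst (run orc (Query T k)) = bind_pmf (orc T) (\<lambda>r. map_pmf fst (run orc (k r)))"
  by (simp add: map_bind_pmf pmf.map_comp o_def case_prod_unfold)

lemma map_fst_run_Random:
  "map_pmf fst (run orc (Random p)) = bind_pmf p (\<lambda>a. map_pmf fst (run orc a))"
  by (simp add: join_pmf_def map_bind_pmf bind_map_pmf)

text \<open>A bound that holds for each outcome of \<open>p\<close> survives averaging, provided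
  that \<open>p\<close> is common to all \<open>S\<close>. This serves internal randomness and those
  pair queries whose answer law no longer depends on \<open>S\<close>.\<close>

lemma sum_pmf_bind_ge:
  fixes F :: "'s \<Rightarrow> 'a \<Rightarrow> 'b pmf"
  assumes "\<And>a. a \<in> set_pmf p \<Longrightarrow> c * pmf (G a) v \<le> (\<Sum>S\<in>C. pmf (F S a) v)"
  shows "c * pmf (bind_pmf p G) v \<le> (\<Sum>S\<in>C. pmf (bind_pmf p (F S)) v)"
proof -
  have int: "integrable (measure_pmf p) (\<lambda>a. pmf (H a) v)" for H :: "'a \<Rightarrow> 'b pmf"
    by (rule measure_pmf.integrable_const_bound[where B = 1]) (auto simp: pmf_le_1)
  have "c * pmf (bind_pmf p G) v = (\<integral>a. c * pmf (G a) v \<partial>measure_pmf p)"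
    by (simp add: pmf_bind)
  also have "\<dots> \<le> (\<integral>a. (\<Sum>S\<in>C. pmf (F S a) v) \<partial>measure_pmf p)"
    using assms int by (intro integral_mono_AE) (auto simp: AE_measure_pmf_iff)
  also have "\<dots> = (\<Sum>S\<in>C. pmf (bind_pmf p (F S)) v)"
    using int by (simp add: pmf_bind)
  finally show ?thesis .
qed

lemma pmf_bind_map_pmf_of_set:
  assumes "finite A" "A \<noteq> {}"
  shows "pmf (bind_pmf (map_pmf f (pmf_of_set A)) g) v = (\<Sum>x\<in>A. pmf (g (f x)) v) / card A"
  using assms by (simp add: bind_map_pmf pmf_bind integral_pmf_of_set)

section \<open>Query budgets of subtrees\<close>

text \<open>The budget is relative to a family of supports, since it is assumed only on promise
  inputs and must pass to subtrees while the family shrinks.\<close>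

definition bounded_on :: "nat \<Rightarrow> nat set set \<Rightarrow> (nat set, nat option) algorithm \<Rightarrow> bool" where
  "bounded_on m \<S> A \<longleftrightarrow> makes_at_most m (pmf_of_set ` \<S>) A"

lemma bounded_on_Random:
  assumes "bounded_on m \<S> (Random p)" "a \<in> set_pmf p"
  shows "bounded_on m \<S> a"
  using assms by (fastforce simp: bounded_on_def makes_at_most_def)

text \<open>Since \<open>r\<close> is a possible answer under every remaining support, each run of
  \<open>k r\<close> extends to a run of the whole query that is one call longer.\<close>

lemma bounded_on_Query:
  assumes "bounded_on m \<S> (Query T k)" "\<S>' \<subseteq> \<S>"
    and "\<And>S. S \<in> \<S>' \<Longrightarrow> r \<in> set_pmf (pcond (pmf_of_set S) T)"
  shows "bounded_on (m - 1) \<S>' (k r)"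
  unfolding bounded_on_def makes_at_most_def
proof safe
  fix S w n
  assume S: "S \<in> \<S>'" and n: "(w, n) \<in> set_pmf (run (pcond (pmf_of_set S)) (k r))"
  have "(w, Suc n) \<in> set_pmf (run (pcond (pmf_of_set S)) (Query T k))"
    using assms(3)[OF S] n by force
  then have "Suc n \<le> m"
    using assms(1,2) S unfolding bounded_on_def makes_at_most_def by blast
  then show "n \<le> m - 1" by simp
qed

lemma bounded_on_Query_pos:
  assumes "bounded_on m \<S> (Query T k)" "\<S> \<noteq> {}"
  shows "0 < m"
proof -
  obtain S where S: "S \<in> \<S>" using assms by blast
  obtain x where x: "x \<in> set_pmf (run (pcond (pmf_of_set S)) (Query T k))"
    using set_pmf_not_empty by fast
  then obtain w n where "x = (w, Suc n)" by auto
  then show ?thesis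
    using assms S x unfolding bounded_on_def makes_at_most_def by fastforce
qed

section \<open>Comparison with the ideal process\<close>

text \<open>
  The likelihood ratio bound, conditioned on the knowledge \<open>X\<close>, \<open>Y\<close>. It is one-sided, so the
  supports on which the ideal answers are wrong are simply dropped; each query costs a factor
  \<open>1 - \<delta>\<close>.
\<close>

lemma ideal_le_sum:
  fixes \<delta> :: real
  assumes \<delta>: "0 \<le> \<delta>" "\<delta> \<le> 1" and s: "0 < s" and qs: "real q \<le> \<delta> * s"
    and sN: "2 * real s \<le> \<delta> * (real N - 3 * real q)" and qN: "3 * q < N"
    and "queries A \<subseteq> pcond_queries N"
    and "X \<subseteq> {1..N}" "Y \<subseteq> {1..N}" "X \<inter> Y = {}"
    and "card X + m \<le> q" "card Y + 2 * m \<le> 2 * q"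
    and "bounded_on m (supports N s X Y) A"
  shows "(1 - \<delta>) ^ m * card (supports N s X Y) * pmf (ideal N A X Y) v
      \<le> (\<Sum>S\<in>supports N s X Y. pmf (map_pmf fst (run (pcond (pmf_of_set S)) A)) v)"
  using assms(7-)
proof (induction A arbitrary: X Y m)
  case (Output w)
  have "(1 - \<delta>) ^ m * (card (supports N s X Y) * pmf (return_pmf w) v)
      \<le> 1 * (card (supports N s X Y) * pmf (return_pmf w) v)"
    using \<delta> by (intro mult_right_mono power_le_one) auto
  then show ?case by (simp add: mult.assoc)
next
  case (Random p)
  show ?case
    unfolding map_fst_run_Random ideal.simps bind_map_pmf
  proof (rule sum_pmf_bind_ge)
    fix a assume a: "a \<in> set_pmf p"
    show "(1 - \<delta>) ^ m * card (supports N s X Y) * pmf (ideal N a X Y) v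
      \<le> (\<Sum>S\<in>supports N s X Y. pmf (map_pmf fst (run (pcond (pmf_of_set S)) a)) v)"
      using Random.prems a
      by (intro Random.IH bounded_on_Random[OF Random.prems(7)]) auto
  qed
next
  case (Query T k)
  let ?C = "supports N s X Y"
  let ?P = "\<lambda>S A. pmf (map_pmf fst (run (pcond (pmf_of_set S)) A)) v"
  show ?case
  proof (cases "?C = {}")
    case True
    then show ?thesis by simp
  next
    case False
    then have "0 < m" by (rule bounded_on_Query_pos[OF Query.prems(7)])
    then obtain l where m: "m = Suc l" using gr0_implies_Suc by blast
    have T: "T \<subseteq> {1..N}" "card T = 2 \<or> T = {1..N}"
      using Query.prems(1) by (auto simp: pcond_queries_def)
    have qk: "queries (k r) \<subseteq> pcond_queries N" for r
      using Query.prems(1) by auto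
    have fX: "finite X" and fY: "finite Y" and fT: "finite T"
      using Query.prems(2,3) T(1) finite_subset by blast+
    have S: "finite S" "S \<noteq> {}" "X \<subseteq> S" "S \<subseteq> {1..N} - Y" "card S = s"
      if "S \<in> supports N s X' Y'" "X \<subseteq> X'" "Y \<subseteq> Y'" for S X' Y'
      using that s finite_subset[of S "{1..N}"] by (auto simp: supports_def)
    have Xs: "card X \<le> s"
    proof -
      obtain S where "S \<in> ?C" using False by blast
      then show ?thesis using S[of S X Y] by (metis card_mono order_refl)
    qed
    have XYN: "card X + card Y < N"
      using Query.prems(5,6) qN m by linarith
    show ?thesis
    proof (cases "card T = 2")
      case True
      \<comment> \<open>On supports avoiding \<open>T - X\<close> one has
        \<open>T \<inter> S = T \<inter> X\<close>, so all of them answer with the same law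
        \<open>ans\<close>, which is also the ideal one.\<close>
      define Y' where "Y' = Y \<union> (T - X)"
      define ans where "ans = (if T \<inter> X = {} then return_pmf None else map_pmf Some (pmf_of_set (T \<inter> X)))"
      have sub: "supports N s X Y' \<subseteq> ?C" by (auto simp: supports_def Y'_def)
      have pc: "pcond (pmf_of_set S) T = ans" if "S \<in> supports N s X Y'" for S
      proof -
        have "T \<inter> S = T \<inter> X" using that by (auto simp: supports_def Y'_def)
        moreover have "finite S" "S \<noteq> {}" using S[OF that] by (auto simp: Y'_def)
        ultimately show ?thesis by (simp add: pcond_pmf_of_set ans_def)
      qed
      have cT: "card (T - X) \<le> 2" using True card_mono[OF fT, of "T - X"] by auto
      have "(1 - \<delta>) * card ?C \<le> card (supports N s X Y')"
        unfolding Y'_def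
      proof (rule card_supports_exclude)
        \<comment> \<open>At most \<open>q\<close> sampled points and two excluded points per query:
          this is the origin of \<open>3 * q\<close> in the hypotheses.\<close>
        have "real (card X) + real (card Y) \<le> 3 * real q"
          using Query.prems(5,6) by linarith
        then have "\<delta> * (real N - 3 * real q) \<le> \<delta> * (real N - card X - card Y)"
          using \<delta> by (intro mult_left_mono) auto
        then show "2 * real s \<le> \<delta> * (real N - card X - card Y)" using sN by linarith
      qed (use Query.prems T cT \<delta> Xs XYN in auto)
      then have "(1 - \<delta>) ^ l * pmf (bind_pmf ans (\<lambda>r. ideal N (k r) X Y')) v * ((1 - \<delta>) * card ?C)
          \<le> (1 - \<delta>) ^ l * pmf (bind_pmf ans (\<lambda>r. ideal N (k r) X Y')) v * card (supports N s X Y')"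
        using \<delta> by (intro mult_left_mono) auto
      then have "(1 - \<delta>) ^ m * card ?C * pmf (ideal N (Query T k) X Y) v
          \<le> (1 - \<delta>) ^ l * card (supports N s X Y') * pmf (bind_pmf ans (\<lambda>r. ideal N (k r) X Y')) v"
        using True by (simp add: m ans_def Y'_def mult_ac)
      also have "\<dots> \<le> (\<Sum>S\<in>supports N s X Y'.
          pmf (bind_pmf ans (\<lambda>r. map_pmf fst (run (pcond (pmf_of_set S)) (k r)))) v)"
      proof (rule sum_pmf_bind_ge)
        fix r assume r: "r \<in> set_pmf ans"
        have "bounded_on (m - 1) (supports N s X Y') (k r)"
          using Query.prems(7) sub by (rule bounded_on_Query) (use r pc in auto)
        moreover have "card Y' \<le> card Y + 2"
          using card_Un_le[of Y "T - X"] cT by (simp add: Y'_def)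
        ultimately show "(1 - \<delta>) ^ l * card (supports N s X Y') * pmf (ideal N (k r) X Y') v
            \<le> (\<Sum>S\<in>supports N s X Y'. ?P S (k r))"
          using Query.prems T m by (intro Query.IH qk) (auto simp: Y'_def)
      qed
      also have "\<dots> = (\<Sum>S\<in>supports N s X Y'. ?P S (Query T k))"
        by (intro sum.cong) (auto simp: map_fst_run_Query pc simp del: run.simps)
      also have "\<dots> \<le> (\<Sum>S\<in>?C. ?P S (Query T k))"
        using sub by (intro sum_mono2) auto
      finally show ?thesis .
    next
      case nT: False
      define U where "U = {1..N} - X - Y"
      have fU: "finite U" by (simp add: U_def)
      have TN: "T = {1..N}" using T nT by blast
      have cU: "real (card U) = real N - card X - card Y"
      proof -
        have "Y \<subseteq> {1..N} - X" using Query.prems by auto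
        then have "card U = N - card X - card Y"
          using fX fY Query.prems by (simp add: U_def card_Diff_subset)
        then show ?thesis using XYN by simp
      qed
      have u: "real (card U) > 0" using cU XYN by linarith
      have Une: "U \<noteq> {}" using u by auto
      let ?Q = "\<lambda>z. pmf (ideal N (k (Some z)) (insert z X) Y) v"
      have ins: "real (card (supports N s (insert z X) Y)) = (real s - card X) / card U * card ?C"
        if "z \<in> U" for z
      proof -
        have "real (card U) * card (supports N s (insert z X) Y) = (real s - card X) * card ?C"
          unfolding cU
          by (rule real_card_supports_insert) (use Query.prems Xs XYN that in \<open>auto simp: U_def\<close>)
        then show ?thesis using u by (simp add: field_simps)
      qed
      have IH: "(1 - \<delta>) ^ l * card (supports N s (insert z X) Y) * ?Q z
          \<le> (\<Sum>S\<in>supports N s (insert z X) Y. ?P S (k (Some z)))" if z: "z \<in> U" for z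
      proof -
        have "bounded_on (m - 1) (supports N s (insert z X) Y) (k (Some z))"
          using Query.prems(7)
        proof (rule bounded_on_Query)
          fix S assume S': "S \<in> supports N s (insert z X) Y"
          then have "finite S" "S \<noteq> {}" "T \<inter> S = S" using S[OF S'] TN by auto
          then show "Some z \<in> set_pmf (pcond (pmf_of_set S) T)"
            using S' by (auto simp: pcond_pmf_of_set supports_def)
        qed (auto simp: supports_def)
        then show ?thesis
          using Query.prems m z fX by (intro Query.IH qk) (auto simp: U_def)
      qed
      \<comment> \<open>A real sample is new with probability \<open>(s - card X) / s\<close>, and
        \<open>card X \<le> q \<le> \<delta> * s\<close>. This pays the factor
        \<open>1 - \<delta>\<close> for a sample.\<close>
      have "(1 - \<delta>) * real s \<le> real s - card X"
        using qs Query.prems(5) by (simp add: algebra_simps)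
      then have "1 - \<delta> \<le> (real s - card X) / s" using s by (simp add: field_simps)
      moreover have "0 \<le> (1 - \<delta>) ^ l * card ?C * ((\<Sum>z\<in>U. ?Q z) / card U)"
        using \<delta> by (intro mult_nonneg_nonneg divide_nonneg_nonneg sum_nonneg) auto
      ultimately have "(1 - \<delta>) * ((1 - \<delta>) ^ l * card ?C * ((\<Sum>z\<in>U. ?Q z) / card U))
          \<le> (real s - card X) / s * ((1 - \<delta>) ^ l * card ?C * ((\<Sum>z\<in>U. ?Q z) / card U))"
        by (rule mult_right_mono)
      moreover have "pmf (ideal N (Query T k) X Y) v = (\<Sum>z\<in>U. ?Q z) / card U"
        using nT fU Une by (simp add: pmf_bind_map_pmf_of_set del: One_nat_def flip: U_def)
      ultimately have "(1 - \<delta>) ^ m * card ?C * pmf (ideal N (Query T k) X Y) v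
          \<le> (real s - card X) / s * ((1 - \<delta>) ^ l * card ?C * ((\<Sum>z\<in>U. ?Q z) / card U))"
        by (simp only: m power_Suc mult.assoc)
      \<comment> \<open>Regrouping: the chance that a sample is new, times the uniform weight on
        \<open>U\<close>, equals the fraction of supports containing \<open>z\<close>, times the
        chance \<open>1 / s\<close> of sampling \<open>z\<close> from such a support.\<close>
      also have "\<dots> = (\<Sum>z\<in>U. (1 - \<delta>) ^ l * ((real s - card X) / card U * card ?C) * ?Q z) / s"
        by (simp only: sum_distrib_left[symmetric]) (simp add: mult_ac)
      also have "\<dots> = (\<Sum>z\<in>U. (1 - \<delta>) ^ l * card (supports N s (insert z X) Y) * ?Q z) / s"
        using ins by (intro arg_cong2[where f = "(/)"] sum.cong) auto
      also have "\<dots> \<le> (\<Sum>z\<in>U. \<Sum>S\<in>supports N s (insert z X) Y. ?P S (k (Some z))) / s"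
        by (intro divide_right_mono sum_mono IH) auto
      also have "(\<Sum>z\<in>U. \<Sum>S\<in>supports N s (insert z X) Y. ?P S (k (Some z)))
          = (\<Sum>z\<in>U. \<Sum>S\<in>{S \<in> ?C. z \<in> S}. ?P S (k (Some z)))"
        by (intro sum.cong) (auto simp: supports_def)
      \<comment> \<open>Double counting of the pairs of a support and a new sample in it.\<close>
      also have "\<dots> = (\<Sum>S\<in>?C. \<Sum>z\<in>{z \<in> U. z \<in> S}. ?P S (k (Some z)))"
        by (rule sum.swap_restrict[symmetric]) (use fU in auto)
      also have "\<dots> / s = (\<Sum>S\<in>?C. (\<Sum>z\<in>{z \<in> U. z \<in> S}. ?P S (k (Some z))) / s)"
        by (rule sum_divide_distrib)
      \<comment> \<open>The added terms belong to repeated samples, that is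
        \<open>z \<in> X\<close>, and are nonnegative.\<close>
      also have "\<dots> \<le> (\<Sum>S\<in>?C. (\<Sum>z\<in>S. ?P S (k (Some z))) / s)"
        using S[of _ X Y] by (intro sum_mono divide_right_mono sum_mono2) auto
      also have "\<dots> = (\<Sum>S\<in>?C. ?P S (Query T k))"
      proof (rule sum.cong)
        fix S' assume S': "S' \<in> ?C"
        then have "finite S'" "S' \<noteq> {}" "T \<inter> S' = S'" "card S' = s" using S[OF S'] TN by auto
        then show "(\<Sum>z\<in>S'. ?P S' (k (Some z))) / s = ?P S' (Query T k)"
          by (simp add: map_fst_run_Query pcond_pmf_of_set pmf_bind_map_pmf_of_set del: run.simps)
      qed simp
      finally show ?thesis .
    qed
  qed
qed

section \<open>From the comparison to the query lower bound\<close>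

text \<open>Each support of size \<open>s\<close> gives the wrong verdict \<open>v'\<close>
  probability at most \<open>\<beta>\<close>, hence so does their average. The comparison, started
  with no knowledge, transfers this to the ideal process.\<close>

lemma ideal_error_le:
  fixes \<delta> \<beta> :: real
  assumes \<delta>: "0 \<le> \<delta>" "\<delta> \<le> 1" and s: "0 < s" "s \<le> N" and qs: "real q \<le> \<delta> * s"
    and sN: "2 * real s \<le> \<delta> * (real N - 3 * real q)" and qN: "3 * q < N"
    and A: "queries A \<subseteq> pcond_queries N" "bounded_on q (supports N s {} {}) A"
    and correct: "\<And>S. S \<in> supports N s {} {} \<Longrightarrow>
      measure_pmf.prob (run (pcond (pmf_of_set S)) A) {(w, n). w = v} \<ge> 1 - \<beta>"
    and "v' \<noteq> v"
  shows "(1 - \<delta>) ^ q * pmf (ideal N A {} {}) v' \<le> \<beta>"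
proof -
  let ?C = "supports N s {} {}"
  have "pmf (map_pmf fst (run (pcond (pmf_of_set S)) A)) v' \<le> \<beta>" if "S \<in> ?C" for S
  proof -
    let ?R = "map_pmf fst (run (pcond (pmf_of_set S)) A)"
    have "pmf ?R v = measure_pmf.prob (run (pcond (pmf_of_set S)) A) {(w, n). w = v}"
      by (auto simp: pmf_map intro!: arg_cong2[where f = measure])
    then have "1 - \<beta> \<le> pmf ?R v" using correct[OF that] by simp
    moreover have "pmf ?R v + pmf ?R v' \<le> 1"
      using \<open>v' \<noteq> v\<close> measure_pmf.prob_le_1[of ?R "{v, v'}"]
      by (subst (asm) measure_measure_pmf_finite) simp_all
    ultimately show ?thesis by linarith
  qed
  then have "(\<Sum>S\<in>?C. pmf (map_pmf fst (run (pcond (pmf_of_set S)) A)) v') \<le> card ?C * \<beta>"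
    by (rule sum_bounded_above)
  moreover have "(1 - \<delta>) ^ q * card ?C * pmf (ideal N A {} {}) v'
      \<le> (\<Sum>S\<in>?C. pmf (map_pmf fst (run (pcond (pmf_of_set S)) A)) v')"
    by (rule ideal_le_sum[OF \<delta> s(1) qs sN qN]) (use A in auto)
  ultimately have "card ?C * ((1 - \<delta>) ^ q * pmf (ideal N A {} {}) v') \<le> card ?C * \<beta>"
    by (simp add: mult_ac)
  moreover have "card ?C > 0"
    using s by (simp add: card_supports zero_less_binomial)
  ultimately show ?thesis by simp
qed

lemma pmf_of_set_in_promise:
  assumes "S \<in> supports N s {} {}" "0 < s"
  shows "s = nat \<lfloor>real N powr (2/3) / K\<rfloor> \<Longrightarrow> pmf_of_set S \<in> Pi_Yes K N"
    and "s = nat \<lfloor>real N powr (2/3)\<rfloor> \<Longrightarrow> pmf_of_set S \<in> Pi_No N"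
proof -
  have S: "S \<subseteq> {1..N}" "card S = s" using assms by (auto simp: supports_def)
  then have "finite S" "S \<noteq> {}" using assms(2) finite_subset by auto
  then show "s = nat \<lfloor>real N powr (2/3) / K\<rfloor> \<Longrightarrow> pmf_of_set S \<in> Pi_Yes K N"
    and "s = nat \<lfloor>real N powr (2/3)\<rfloor> \<Longrightarrow> pmf_of_set S \<in> Pi_No N"
    using S by (auto simp: Pi_Yes_def Pi_No_def distributions_over_def flat_def)
qed

text \<open>In terms of \<open>x\<close>, the domain has size \<open>x ^ 3\<close> and the No
  supports have size about \<open>x ^ 2\<close>. If \<open>q\<close> were below
  \<open>x / (8 * K)\<close>, both support sizes could be compared with one ideal process, which
  would have to reject both verdicts.\<close>

lemma pcond_tester_lower_bound:
  fixes K x :: real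
  assumes K: "1 \<le> K" and x: "x = real N powr (1/3)" "4 * K \<le> x"
    and test: "bpp_tester N (Pi_Yes K N) (Pi_No N) (1/100) A"
    and most: "makes_at_most q (Pi_Yes K N \<union> Pi_No N) A"
  shows "x / (8 * K) \<le> q"
proof (rule ccontr)
  assume "\<not> x / (8 * K) \<le> q"
  then have q: "real q * (8 * K) < x" using K by (simp add: field_simps)
  have x4: "4 \<le> x" using x K by linarith
  then have N0: "0 < N" using x by (cases "N = 0") auto
  have N: "real N = x ^ 3" and x2: "real N powr (2/3) = x ^ 2"
    using N0 by (simp_all add: x powr_powr flip: powr_realpow)
  define sY sN where "sY = nat \<lfloor>real N powr (2/3) / K\<rfloor>" and "sN = nat \<lfloor>real N powr (2/3)\<rfloor>"
  \<comment> \<open>The value comes from pair queries: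
    \<open>2 * s \<le> \<delta> * (N - 3 * q)\<close> must hold for \<open>s\<close> up to
    \<open>x ^ 2\<close>, where only \<open>N - 3 * q \<ge> x ^ 3 / 2\<close> is used. The condition
    \<open>q \<le> \<delta> * s\<close> then holds with room to spare.\<close>
  define \<delta> where "\<delta> = 4 / x"
  have \<delta>: "0 \<le> \<delta>" "\<delta> \<le> 1" using x4 by (auto simp: \<delta>_def)
  have xxK: "2 * K \<le> x ^ 2"
  proof -
    have "4 * (4 * K) \<le> x * x" using x x4 K by (intro mult_mono) auto
    then show ?thesis using K by (simp add: power2_eq_square)
  qed
  \<comment> \<open>Rounding down loses at most 1, which is at most half of
    \<open>x ^ 2 / K\<close>.\<close>
  have sY_ge: "x ^ 2 / (2 * K) \<le> sY"
  proof -
    have "x ^ 2 / K - 1 \<le> sY" unfolding sY_def x2 by linarith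
    moreover have "1 \<le> x ^ 2 / (2 * K)" using xxK K by (simp add: field_simps)
    moreover have "x ^ 2 / K = 2 * (x ^ 2 / (2 * K))" by simp
    ultimately show ?thesis by linarith
  qed
  have "sY \<le> sN"
  proof -
    have "x ^ 2 / K \<le> x ^ 2" using K by (simp add: divide_le_eq mult_left_le_one_le mult_le_cancel_left1)
    then show ?thesis unfolding sY_def sN_def x2 by (intro nat_mono floor_mono)
  qed
  have "real sN \<le> x ^ 2" unfolding sN_def x2 by simp
  have "sY > 0"
  proof -
    have "x ^ 2 / (2 * K) > 0" using x4 K by simp
    then show ?thesis using sY_ge by linarith
  qed
  have x3: "x ^ 2 * 4 \<le> x ^ 3" using x4 by (simp add: power2_eq_square power3_eq_cube)
  have qx: "8 * real q \<le> x"
  proof -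
    have "8 * real q * 1 \<le> 8 * real q * K" using K by (intro mult_left_mono) auto
    then show ?thesis using q by linarith
  qed
  have xx2: "x \<le> x ^ 2" using x4 by (simp add: power2_eq_square)
  have half: "x ^ 3 / 2 \<le> real N - 3 * q" using qx x3 xx2 N x4 by linarith
  have qN: "3 * q < N" using qx x3 xx2 N x4 by linarith
  have good: "0 < s" "s \<le> N" "real q \<le> \<delta> * s" "2 * real s \<le> \<delta> * (real N - 3 * real q)"
    if "s = sY \<or> s = sN" for s
  proof -
    have s: "sY \<le> s" "s \<le> sN" using that \<open>sY \<le> sN\<close> by auto
    then have s': "x ^ 2 / (2 * K) \<le> s" "real s \<le> x ^ 2"
      using sY_ge \<open>real sN \<le> x ^ 2\<close> by linarith+
    show "0 < s" using s \<open>sY > 0\<close> by linarith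
    show "s \<le> N" using s'(2) x3 N zero_le_power2[of x] by linarith
    have "real q \<le> \<delta> * (x ^ 2 / (2 * K))"
      using q K x4 by (simp add: \<delta>_def power2_eq_square field_simps)
    also have "\<dots> \<le> \<delta> * s" using \<delta> s' by (intro mult_left_mono) auto
    finally show "real q \<le> \<delta> * s" .
    have "2 * real s \<le> \<delta> * (x ^ 3 / 2)"
      using s' x4 by (simp add: \<delta>_def power2_eq_square power3_eq_cube)
    also have "\<dots> \<le> \<delta> * (real N - 3 * real q)" using \<delta> half by (intro mult_left_mono) auto
    finally show "2 * real s \<le> \<delta> * (real N - 3 * real q)" .
  qed
  have good_sY: "sY = sY \<or> sY = sN" and good_sN: "sN = sY \<or> sN = sN" by simp_all
  have yes: "pmf_of_set S \<in> Pi_Yes K N" if "S \<in> supports N sY {} {}" for S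
    using pmf_of_set_in_promise(1)[OF that] good(1)[OF good_sY] by (simp add: sY_def)
  have no: "pmf_of_set S \<in> Pi_No N" if "S \<in> supports N sN {} {}" for S
    using pmf_of_set_in_promise(2)[OF that] good(1)[OF good_sN] by (simp add: sN_def)
  have A: "queries A \<subseteq> pcond_queries N" using test by (simp add: bpp_tester_def)
  have "(1 - \<delta>) ^ q * pmf (ideal N A {} {}) No \<le> 1/100"
  proof (rule ideal_error_le[OF \<delta> good[OF good_sY] qN A])
    show "bounded_on q (supports N sY {} {}) A"
      using most yes unfolding bounded_on_def makes_at_most_def by blast
    show "measure_pmf.prob (run (pcond (pmf_of_set S)) A) {(w, n). w = Yes} \<ge> 1 - 1/100"
      if "S \<in> supports N sY {} {}" for S
      using test yes[OF that] unfolding bpp_tester_def by blast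
  qed auto
  moreover have "(1 - \<delta>) ^ q * pmf (ideal N A {} {}) Yes \<le> 1/100"
  proof (rule ideal_error_le[OF \<delta> good[OF good_sN] qN A])
    show "bounded_on q (supports N sN {} {}) A"
      using most no unfolding bounded_on_def makes_at_most_def by blast
    show "measure_pmf.prob (run (pcond (pmf_of_set S)) A) {(w, n). w = No} \<ge> 1 - 1/100"
      if "S \<in> supports N sN {} {}" for S
      using test no[OF that] unfolding bpp_tester_def by blast
  qed auto
  \<comment> \<open>The ideal process does not involve the support size, so the two errors are
    complementary events of a single distribution.\<close>
  moreover have "pmf (ideal N A {} {}) Yes + pmf (ideal N A {} {}) No = 1"
  proof -
    have "(UNIV :: verdict set) = {Yes, No}" using verdict.exhaust by auto
    then have "measure_pmf.prob (ideal N A {} {}) {Yes, No} = 1" by (metis measure_pmf_UNIV)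
    then show ?thesis by (simp add: measure_measure_pmf_finite)
  qed
  then have "(1 - \<delta>) ^ q
      = (1 - \<delta>) ^ q * pmf (ideal N A {} {}) Yes + (1 - \<delta>) ^ q * pmf (ideal N A {} {}) No"
    by (metis distrib_left mult.right_neutral)
  \<comment> \<open>From \<open>q \<le> x / 8\<close> and \<open>\<delta> = 4 / x\<close>. With
    Bernoulli's inequality the two error bounds would give \<open>1/2 \<le> 2/100\<close>.\<close>
  moreover have "1 / 2 \<le> 1 - q * \<delta>"
    using qx x4 by (simp add: \<delta>_def field_simps)
  moreover have "1 - q * \<delta> \<le> (1 - \<delta>) ^ q"
    using Bernoulli_inequality[of "- \<delta>" q] \<delta> by simp
  ultimately show False by linarith
qed

theorem theorem3p6:
  "\<exists>K0::real. \<forall>K\<ge>K0. \<exists>c::real. c > 0 \<and>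
     (\<forall>\<^sub>F N in sequentially. \<forall>(A :: (nat set, nat option) algorithm) (q :: nat).
        bpp_tester N (Pi_Yes K N) (Pi_No N) (1/100) A \<longrightarrow>
        makes_at_most q (Pi_Yes K N \<union> Pi_No N) A \<longrightarrow>
        real q \<ge> c * real N powr (1/3))"
\<comment> \<open>Taking \<open>K0 = 1\<close> suffices: \<open>1 \<le> K\<close> orders the two
  support sizes, and together with \<open>4 * K \<le> x\<close> it gives \<open>4 \<le> x\<close>,
  hence \<open>\<delta> \<le> 1\<close>.\<close>
proof (rule exI[of _ 1], intro allI impI)
  fix K :: real
  assume K: "1 \<le> K"
  have "filterlim (\<lambda>N. real N powr (1/3)) at_top sequentially"
    by real_asymp
  then have large: "\<forall>\<^sub>F N in sequentially. 4 * K \<le> real N powr (1/3)"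
    by (simp add: filterlim_at_top)
  show "\<exists>c>0. \<forall>\<^sub>F N in sequentially. \<forall>(A :: (nat set, nat option) algorithm) q.
        bpp_tester N (Pi_Yes K N) (Pi_No N) (1/100) A \<longrightarrow>
        makes_at_most q (Pi_Yes K N \<union> Pi_No N) A \<longrightarrow>
        real q \<ge> c * real N powr (1/3)"
  proof (intro exI[of _ "1 / (8 * K)"] conjI)
    show "\<forall>\<^sub>F N in sequentially. \<forall>(A :: (nat set, nat option) algorithm) q.
        bpp_tester N (Pi_Yes K N) (Pi_No N) (1/100) A \<longrightarrow>
        makes_at_most q (Pi_Yes K N \<union> Pi_No N) A \<longrightarrow>
        real q \<ge> 1 / (8 * K) * real N powr (1/3)"
      using large
      by eventually_elim (use pcond_tester_lower_bound[OF K refl] in auto)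
  qed (use K in auto)
qed

end
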